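(* Let $S$ be an abstract complete pseudogroup and let $R_S\subseteq S\times\mathcal{L}^\vee(S)$ be its pseudogroup membership context, i.e. $sR_SU\iff s\in U$. For every $A\subseteq S$, $$R_S^{\downarrow}R_S^{\uparrow}(A)=\operatorname{cl}_S(A).$$ Consequently, the extents of $R_S$ are precisely the compatibly closed ideals of $S$, and $$\mathsf{M}R_S\cong\mathcal{L}^\vee(S)$$ as unital involutive quantales.
   Context: An inverse semigroup $S$ (inverse of $s$ written $s^{-1}$) has natural order $s\leq t\iff s=et$ for some idempotent $e\in S$. A subset of $S$ is compatible if $s^{-1}t$ and $st^{-1}$ are idempotent for all $s,t$ in it. An abstract complete pseudogroup is an inverse semigroup $S$ that is complete (every compatible subset, including the empty one, has a supremum in the natural order; in particular $S$ is an inverse monoid with unit $1_S$) and infinitely distributive (multiplication, on either side, distributes over suprema of compatible subsets). $\mathcal{L}^\vee(S)$ is the set of compatibly closed ideals of $S$: subsets downward closed in the natural order and closed under suprema of compatible subsets. For $A\subseteq S$, $\operatorname{cl}_S(A)=\bigcap\{U\in\mathcal{L}^\vee(S)\mid A\subseteq U\}$. For $A,B\subseteq S$, $A*B=\{ab\mid a\in A,\ b\in B\}$. It is known that $\mathcal{L}^\vee(S)$, ordered by inclusion, is a unital involutive quantale with multiplication $U\star V=\operatorname{cl}_S(U*V)$, unit $\downarrow 1_S=\{s\in S\mid s\leq 1_S\}$ and involution $U^\dagger=\{u^{-1}\mid u\in U\}$. (A quantale is a complete lattice with an associative multiplication preserving suprema in each variable; an involution is a sup-preserving map with $a^{\dagger\dagger}=a$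 and $(a*b)^\dagger=b^\dagger*a^\dagger$.) For a relation $R\subseteq X\times Y$, put $R^{\uparrow}(A)=\{y\in Y\mid\forall a\in A,\ aRy\}$ and $R^{\downarrow}(B)=\{x\in X\mid\forall b\in B,\ xRb\}$; an extent of $R$ is a subset $A\subseteq X$ with $A=R^{\downarrow}R^{\uparrow}(A)$, and $\mathsf{M}R$ is the complete lattice of extents ordered by inclusion. $R_S$ is residuated: there are maps $\swarrow\colon\mathcal{L}^\vee(S)\times S\to\mathcal{L}^\vee(S)$ and $\searrow\colon S\times\mathcal{L}^\vee(S)\to\mathcal{L}^\vee(S)$ with $(st)R_SU\iff sR_S(U\swarrow t)\iff tR_S(s\searrow U)$. Hence $\mathsf{M}R_S$ is a quantale with multiplication $A\otimes_{R_S}B=R_S^{\downarrow}R_S^{\uparrow}(A*B)$ and suprema $\bigsqcup_iA_i=R_S^{\downarrow}R_S^{\uparrow}(\bigcup_iA_i)$; its unit is $\downarrow 1_S$ and its involution is the pointwise inverse $A\mapsto\{a^{-1}\mid a\in A\}$. *)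

theory Defs
  imports "HOL-Algebra.Complete_Lattice"
begin

section \<open>Inverse semigroups and abstract complete pseudogroups\<close>

record 'a semigroup_struct = "'a partial_object" +
  smult :: "'a \<Rightarrow> 'a \<Rightarrow> 'a" (infixl "\<cdot>\<index>" 70)

locale inverse_semigroup =
  fixes S (structure)
  assumes smult_closed: "\<lbrakk>s \<in> carrier S; t \<in> carrier S\<rbrakk> \<Longrightarrow> s \<cdot> t \<in> carrier S"
    and smult_assoc:
      "\<lbrakk>s \<in> carrier S; t \<in> carrier S; u \<in> carrier S\<rbrakk> \<Longrightarrow> (s \<cdot> t) \<cdot> u = s \<cdot> (t \<cdot> u)"
    and unique_inverse:
      "s \<in> carrier S \<Longrightarrow> \<exists>!t. t \<in> carrier S \<and> s \<cdot> t \<cdot> s = s \<and> t \<cdot> s \<cdot> t = t"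

definition sinv :: "('a, 'b) semigroup_struct_scheme \<Rightarrow> 'a \<Rightarrow> 'a" where
  "sinv S s = (THE t. t \<in> carrier S \<and> s \<cdot>\<^bsub>S\<^esub> t \<cdot>\<^bsub>S\<^esub> s = s \<and> t \<cdot>\<^bsub>S\<^esub> s \<cdot>\<^bsub>S\<^esub> t = t)"

definition idempotents :: "('a, 'b) semigroup_struct_scheme \<Rightarrow> 'a set" where
  "idempotents S = {e \<in> carrier S. e \<cdot>\<^bsub>S\<^esub> e = e}"

definition natural_order :: "('a, 'b) semigroup_struct_scheme \<Rightarrow> 'a gorder" where
  "natural_order S =
    \<lparr>carrier = carrier S, eq = (=), le = (\<lambda>s t. \<exists>e\<in>idempotents S. s = e \<cdot>\<^bsub>S\<^esub> t)\<rparr>"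

definition compatible :: "('a, 'b) semigroup_struct_scheme \<Rightarrow> 'a set \<Rightarrow> bool" where
  "compatible S A \<longleftrightarrow> A \<subseteq> carrier S \<and>
    (\<forall>s\<in>A. \<forall>t\<in>A. sinv S s \<cdot>\<^bsub>S\<^esub> t \<in> idempotents S \<and> s \<cdot>\<^bsub>S\<^esub> sinv S t \<in> idempotents S)"

text \<open>Compatible subsets include the empty one; completeness thus yields a least element,
  and distributivity says that it is a zero.\<close>

locale complete_pseudogroup = inverse_semigroup +
  assumes complete: "compatible S A \<Longrightarrow> \<exists>x. is_lub (natural_order S) x A"
    and distrib_left:
      "\<lbrakk>compatible S A; is_lub (natural_order S) x A; s \<in> carrier S\<rbrakk>
        \<Longrightarrow> is_lub (natural_order S) (s \<cdot> x) ((\<lambda>a. s \<cdot> a) ` A)"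
    and distrib_right:
      "\<lbrakk>compatible S A; is_lub (natural_order S) x A; s \<in> carrier S\<rbrakk>
        \<Longrightarrow> is_lub (natural_order S) (x \<cdot> s) ((\<lambda>a. a \<cdot> s) ` A)"

text \<open>The unit exists in every complete pseudogroup (it is the supremum of the idempotents),
  so it is not part of the structure.\<close>

definition sunit :: "('a, 'b) semigroup_struct_scheme \<Rightarrow> 'a" where
  "sunit S = (THE u. u \<in> carrier S \<and> (\<forall>s\<in>carrier S. u \<cdot>\<^bsub>S\<^esub> s = s \<and> s \<cdot>\<^bsub>S\<^esub> u = s))"

definition down_set :: "('a, 'b) semigroup_struct_scheme \<Rightarrow> 'a \<Rightarrow> 'a set" where
  "down_set S x = {s \<in> carrier S. s \<sqsubseteq>\<^bsub>natural_order S\<^esub> x}"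

section \<open>Unital involutive quantales\<close>

record 'a quantale_struct = "'a gorder" +
  qmult :: "'a \<Rightarrow> 'a \<Rightarrow> 'a"
  qunit :: 'a
  qinvol :: "'a \<Rightarrow> 'a"

locale unital_involutive_quantale = complete_lattice Q for Q (structure) +
  assumes qmult_closed:
      "\<lbrakk>a \<in> carrier Q; b \<in> carrier Q\<rbrakk> \<Longrightarrow> qmult Q a b \<in> carrier Q"
    and qmult_assoc:
      "\<lbrakk>a \<in> carrier Q; b \<in> carrier Q; c \<in> carrier Q\<rbrakk>
        \<Longrightarrow> qmult Q (qmult Q a b) c = qmult Q a (qmult Q b c)"
    and qmult_Sup_right:
      "\<lbrakk>a \<in> carrier Q; B \<subseteq> carrier Q\<rbrakk> \<Longrightarrow> qmult Q a (\<Squnion>B) = \<Squnion>(qmult Q a ` B)"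
    and qmult_Sup_left:
      "\<lbrakk>A \<subseteq> carrier Q; b \<in> carrier Q\<rbrakk> \<Longrightarrow> qmult Q (\<Squnion>A) b = \<Squnion>((\<lambda>a. qmult Q a b) ` A)"
    and qunit_closed: "qunit Q \<in> carrier Q"
    and qunit_left: "a \<in> carrier Q \<Longrightarrow> qmult Q (qunit Q) a = a"
    and qunit_right: "a \<in> carrier Q \<Longrightarrow> qmult Q a (qunit Q) = a"
    and qinvol_closed: "a \<in> carrier Q \<Longrightarrow> qinvol Q a \<in> carrier Q"
    and qinvol_Sup: "A \<subseteq> carrier Q \<Longrightarrow> qinvol Q (\<Squnion>A) = \<Squnion>(qinvol Q ` A)"
    and qinvol_qinvol: "a \<in> carrier Q \<Longrightarrow> qinvol Q (qinvol Q a) = a"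
    and qinvol_qmult:
      "\<lbrakk>a \<in> carrier Q; b \<in> carrier Q\<rbrakk>
        \<Longrightarrow> qinvol Q (qmult Q a b) = qmult Q (qinvol Q b) (qinvol Q a)"

definition uiq_iso ::
  "('a, 'c) quantale_struct_scheme \<Rightarrow> ('b, 'd) quantale_struct_scheme \<Rightarrow> ('a \<Rightarrow> 'b) set" where
  "uiq_iso P Q = {h. bij_betw h (carrier P) (carrier Q) \<and>
    (\<forall>A. A \<subseteq> carrier P \<longrightarrow> h (\<Squnion>\<^bsub>P\<^esub>A) = \<Squnion>\<^bsub>Q\<^esub>(h ` A)) \<and>
    (\<forall>a\<in>carrier P. \<forall>b\<in>carrier P. h (qmult P a b) = qmult Q (h a) (h b)) \<and>
    h (qunit P) = qunit Q \<and>
    (\<forall>a\<in>carrier P. h (qinvol P a) = qinvol Q (h a))}"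

definition uiq_isomorphic ::
  "('a, 'c) quantale_struct_scheme \<Rightarrow> ('b, 'd) quantale_struct_scheme \<Rightarrow> bool"
  (infix "\<cong>\<^sub>u\<^sub>i\<^sub>q" 50) where
  "P \<cong>\<^sub>u\<^sub>i\<^sub>q Q \<longleftrightarrow>
    unital_involutive_quantale P \<and> unital_involutive_quantale Q \<and> uiq_iso P Q \<noteq> {}"

section \<open>Compatibly closed ideals\<close>

definition cc_ideals :: "('a, 'b) semigroup_struct_scheme \<Rightarrow> 'a set set" where
  "cc_ideals S = {U. U \<subseteq> carrier S \<and>
    (\<forall>u\<in>U. \<forall>s\<in>carrier S. s \<sqsubseteq>\<^bsub>natural_order S\<^esub> u \<longrightarrow> s \<in> U) \<and>
    (\<forall>A x. A \<subseteq> U \<longrightarrow> compatible S A \<longrightarrow> is_lub (natural_order S) x A \<longrightarrow> x \<in> U)}"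

definition cc_closure :: "('a, 'b) semigroup_struct_scheme \<Rightarrow> 'a set \<Rightarrow> 'a set" where
  "cc_closure S A = \<Inter>{U \<in> cc_ideals S. A \<subseteq> U}"

definition set_smult :: "('a, 'b) semigroup_struct_scheme \<Rightarrow> 'a set \<Rightarrow> 'a set \<Rightarrow> 'a set" where
  "set_smult S A B = {a \<cdot>\<^bsub>S\<^esub> b | a b. a \<in> A \<and> b \<in> B}"

definition ideal_quantale :: "('a, 'b) semigroup_struct_scheme \<Rightarrow> 'a set quantale_struct" where
  "ideal_quantale S =
    \<lparr>carrier = cc_ideals S, eq = (=), le = (\<subseteq>),
     qmult = (\<lambda>U V. cc_closure S (set_smult S U V)),
     qunit = down_set S (sunit S),
     qinvol = (\<lambda>U. sinv S ` U)\<rparr>"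

section \<open>Extents of a relation and the membership context\<close>

text \<open>A relation \<open>R \<subseteq> X \<times> Y\<close> is given together with its carrier sets, as these enter the polars.\<close>

definition polar_up :: "'y set \<Rightarrow> ('x \<times> 'y) set \<Rightarrow> 'x set \<Rightarrow> 'y set" where
  "polar_up Y R A = {y \<in> Y. \<forall>a\<in>A. (a, y) \<in> R}"

definition polar_down :: "'x set \<Rightarrow> ('x \<times> 'y) set \<Rightarrow> 'y set \<Rightarrow> 'x set" where
  "polar_down X R B = {x \<in> X. \<forall>b\<in>B. (x, b) \<in> R}"

definition extents :: "'x set \<Rightarrow> 'y set \<Rightarrow> ('x \<times> 'y) set \<Rightarrow> 'x set set" where
  "extents X Y R = {A. A \<subseteq> X \<and> A = polar_down X R (polar_up Y R A)}"

definition membership_context :: "('a, 'b) semigroup_struct_scheme \<Rightarrow> ('a \<times> 'a set) set" where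
  "membership_context S = {(s, U). s \<in> carrier S \<and> U \<in> cc_ideals S \<and> s \<in> U}"

definition context_closure :: "('a, 'b) semigroup_struct_scheme \<Rightarrow> 'a set \<Rightarrow> 'a set" where
  "context_closure S A =
    polar_down (carrier S) (membership_context S)
      (polar_up (cc_ideals S) (membership_context S) A)"

definition context_quantale :: "('a, 'b) semigroup_struct_scheme \<Rightarrow> 'a set quantale_struct" where
  "context_quantale S =
    \<lparr>carrier = extents (carrier S) (cc_ideals S) (membership_context S), eq = (=), le = (\<subseteq>),
     qmult = (\<lambda>A B. context_closure S (set_smult S A B)),
     qunit = down_set S (sunit S),
     qinvol = (\<lambda>A. sinv S ` A)\<rparr>"

end

theory Submission
  imports Defs
begin

text \<open>
  A compatibly closed ideal contains \<open>A\<close> iff it belongs to the upper polar of \<open>A\<close>, so the lower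
  polar of the upper polar is the intersection of these ideals, which is the closure of \<open>A\<close>.
  The identity map is then the isomorphism. That the ideals form a quantale rests on the residuals
  \<open>{x. \<forall>b\<in>B. x b \<in> W}\<close> of an ideal \<open>W\<close> being ideals again, by infinite distributivity: this makes
  the closure a nucleus, that is, closing a factor does not change the closure of a product.
\<close>

section \<open>Inverse semigroups\<close>

context inverse_semigroup
begin

abbreviation semigroup_inverse ("\<i> _" [80] 80) where "\<i> s \<equiv> sinv S s"
abbreviation E where "E \<equiv> idempotents S"

lemma sinv_props:
  assumes "s \<in> carrier S"
  shows "\<i> s \<in> carrier S \<and> s \<cdot> \<i> s \<cdot> s = s \<and> \<i> s \<cdot> s \<cdot> \<i> s = \<i> s"
  unfolding sinv_def by (rule theI'[OF unique_inverse[OF assms]])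

lemma sinv_closed [simp]: "s \<in> carrier S \<Longrightarrow> \<i> s \<in> carrier S"
  using sinv_props by blast

declare smult_closed [simp] smult_assoc [simp]

lemma mult_sinv_mult [simp]: "s \<in> carrier S \<Longrightarrow> s \<cdot> (\<i> s \<cdot> s) = s"
  using sinv_props[of s] by simp

lemma sinv_mult_sinv [simp]: "s \<in> carrier S \<Longrightarrow> \<i> s \<cdot> (s \<cdot> \<i> s) = \<i> s"
  using sinv_props[of s] by simp

text \<open>Since \<open>smult_assoc\<close> brackets every product to the right, a cancellation law
  must also match in front of a tail \<open>x\<close>.\<close>

lemma mult_sinv_mult_left [simp]:
  "\<lbrakk>s \<in> carrier S; x \<in> carrier S\<rbrakk> \<Longrightarrow> s \<cdot> (\<i> s \<cdot> (s \<cdot> x)) = s \<cdot> x"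
  by (metis mult_sinv_mult sinv_closed smult_assoc smult_closed)

lemma sinv_mult_sinv_left [simp]:
  "\<lbrakk>s \<in> carrier S; x \<in> carrier S\<rbrakk> \<Longrightarrow> \<i> s \<cdot> (s \<cdot> (\<i> s \<cdot> x)) = \<i> s \<cdot> x"
  by (metis sinv_mult_sinv sinv_closed smult_assoc smult_closed)

lemma sinv_unique:
  "\<lbrakk>s \<in> carrier S; t \<in> carrier S; s \<cdot> t \<cdot> s = s; t \<cdot> s \<cdot> t = t\<rbrakk> \<Longrightarrow> \<i> s = t"
  unfolding sinv_def by (rule the1_equality[OF unique_inverse]) auto

lemma sinv_sinv [simp]: "s \<in> carrier S \<Longrightarrow> \<i> \<i> s = s"
  by (rule sinv_unique) simp_all

section \<open>Idempotents and the inverse of a product\<close>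

lemma idem_closed: "e \<in> E \<Longrightarrow> e \<in> carrier S"
  by (simp add: idempotents_def)

lemma idem_idem: "e \<in> E \<Longrightarrow> e \<cdot> e = e"
  by (simp add: idempotents_def)

lemma idem_idem_left: "\<lbrakk>e \<in> E; x \<in> carrier S\<rbrakk> \<Longrightarrow> e \<cdot> (e \<cdot> x) = e \<cdot> x"
  by (metis idem_closed idem_idem smult_assoc)

lemma idemI: "\<lbrakk>e \<in> carrier S; e \<cdot> e = e\<rbrakk> \<Longrightarrow> e \<in> E"
  by (simp add: idempotents_def)

lemma sinv_idem: "e \<in> E \<Longrightarrow> \<i> e = e"
  by (rule sinv_unique) (simp_all add: idempotents_def)

lemma mult_sinv_idem [simp]: "s \<in> carrier S \<Longrightarrow> s \<cdot> \<i> s \<in> E"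
  by (rule idemI) simp_all

lemma sinv_mult_idem [simp]: "s \<in> carrier S \<Longrightarrow> \<i> s \<cdot> s \<in> E"
  by (rule idemI) simp_all

text \<open>With \<open>x\<close> the inverse of \<open>e \<cdot> f\<close>, the element
  \<open>f \<cdot> x \<cdot> e\<close> is an inverse of \<open>e \<cdot> f\<close> too, hence equal
  to \<open>x\<close>. Squaring it uses \<open>x \<cdot> e \<cdot> f \<cdot> x = x\<close> and shows
  \<open>x\<close> idempotent, so \<open>x\<close> is its own inverse and
  \<open>e \<cdot> f = x\<close>.\<close>

lemma idem_mult:
  assumes e: "e \<in> E" and f: "f \<in> E"
  shows "e \<cdot> f \<in> E"
proof -
  note [simp] = idem_closed[OF e] idem_closed[OF f] idem_idem_left[OF e] idem_idem_left[OF f]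
  define x where "x = \<i> (e \<cdot> f)"
  have x: "x \<in> carrier S" using e f by (simp add: x_def)
  have p: "e \<cdot> (f \<cdot> (x \<cdot> (e \<cdot> f))) = e \<cdot> f" "x \<cdot> (e \<cdot> (f \<cdot> x)) = x"
    using sinv_props[of "e \<cdot> f"] e f x unfolding x_def[symmetric] by simp_all
  have q: "x \<cdot> (e \<cdot> (f \<cdot> (x \<cdot> y))) = x \<cdot> y" if "y \<in> carrier S" for y
    by (metis p(2) e f x that idem_closed smult_assoc smult_closed)
  have "\<i> (e \<cdot> f) = f \<cdot> x \<cdot> e"
    using e f x p q by (intro sinv_unique) simp_all
  then have fxe: "f \<cdot> (x \<cdot> e) = x"
    using e f x by (simp add: x_def)
  have "x \<cdot> x = (f \<cdot> (x \<cdot> e)) \<cdot> (f \<cdot> (x \<cdot> e))"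
    by (simp only: fxe)
  also have "\<dots> = f \<cdot> (x \<cdot> e)" using e f x q by simp
  finally have "x \<in> E" using x fxe by (intro idemI) auto
  then show ?thesis using sinv_idem[of x] by (simp add: x_def)
qed

text \<open>Idempotency of both products makes \<open>f \<cdot> e\<close> an inverse of
  \<open>e \<cdot> f\<close>, but the idempotent \<open>e \<cdot> f\<close> is also its own
  inverse.\<close>

lemma idem_commute:
  assumes e: "e \<in> E" and f: "f \<in> E"
  shows "e \<cdot> f = f \<cdot> e"
proof -
  note [simp] = idem_closed[OF e] idem_closed[OF f] idem_idem_left[OF e] idem_idem_left[OF f]
  have "e \<cdot> (f \<cdot> (e \<cdot> f)) = e \<cdot> f" "f \<cdot> (e \<cdot> (f \<cdot> e)) = f \<cdot> e"
    using idem_idem[OF idem_mult[OF e f]] idem_idem[OF idem_mult[OF f e]] e f by simp_all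
  then have "\<i> (e \<cdot> f) = f \<cdot> e"
    using e f by (intro sinv_unique) simp_all
  then show ?thesis using sinv_idem[OF idem_mult[OF e f]] by simp
qed

lemma idem_left_commute:
  "\<lbrakk>e \<in> E; f \<in> E; x \<in> carrier S\<rbrakk> \<Longrightarrow> e \<cdot> (f \<cdot> x) = f \<cdot> (e \<cdot> x)"
  by (metis idem_closed idem_commute smult_assoc)

lemma sinv_mult [simp]:
  assumes s: "s \<in> carrier S" and t: "t \<in> carrier S"
  shows "\<i> (s \<cdot> t) = \<i> t \<cdot> \<i> s"
proof (rule sinv_unique)
  \<comment> \<open>The idempotents \<open>t \<cdot> \<i> t\<close> and
    \<open>\<i> s \<cdot> s\<close> commute; swapping them brings \<open>s\<close> next to
    \<open>\<i> s\<close> and \<open>t\<close> next to \<open>\<i> t\<close>.\<close>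
  have c: "t \<cdot> (\<i> t \<cdot> (\<i> s \<cdot> (s \<cdot> x))) = \<i> s \<cdot> (s \<cdot> (t \<cdot> (\<i> t \<cdot> x)))" if "x \<in> carrier S" for x
    using idem_left_commute[of "t \<cdot> \<i> t" "\<i> s \<cdot> s" x] s t that by simp
  show "s \<cdot> t \<cdot> (\<i> t \<cdot> \<i> s) \<cdot> (s \<cdot> t) = s \<cdot> t"
    using s t c[of t] by simp
  show "\<i> t \<cdot> \<i> s \<cdot> (s \<cdot> t) \<cdot> (\<i> t \<cdot> \<i> s) = \<i> t \<cdot> \<i> s"
    using s t c[of "\<i> s"] by simp
qed (use s t in simp_all)

lemma conj_idem:
  assumes s: "s \<in> carrier S" and e: "e \<in> E"
  shows "s \<cdot> (e \<cdot> \<i> s) \<in> E"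
  supply [simp] = idem_closed[OF e] idem_idem_left[OF e]
proof (rule idemI)
  have "e \<cdot> (\<i> s \<cdot> (s \<cdot> (e \<cdot> \<i> s))) = \<i> s \<cdot> (s \<cdot> (e \<cdot> \<i> s))"
    using idem_left_commute[of e "\<i> s \<cdot> s" "e \<cdot> \<i> s"] s e by simp
  then show "s \<cdot> (e \<cdot> \<i> s) \<cdot> (s \<cdot> (e \<cdot> \<i> s)) = s \<cdot> (e \<cdot> \<i> s)"
    using s e by simp
qed (use s e in simp)

text \<open>An idempotent can be moved from the right of \<open>s\<close> to its left at the price
  of conjugation, because \<open>e\<close> commutes with \<open>\<i> s \<cdot> s\<close>.\<close>

lemma mult_idem_eq:
  assumes s: "s \<in> carrier S" and e: "e \<in> E"
  shows "s \<cdot> e = s \<cdot> (e \<cdot> \<i> s) \<cdot> s"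
  using idem_commute[of e "\<i> s \<cdot> s"] s e by (simp add: idem_closed)

subsection \<open>The natural order\<close>

abbreviation nle (infix "\<preceq>" 50) where "s \<preceq> t \<equiv> s \<sqsubseteq>\<^bsub>natural_order S\<^esub> t"

lemma carrier_natural_order [simp]: "carrier (natural_order S) = carrier S"
  by (simp add: natural_order_def)

lemma nle_iff: "s \<preceq> t \<longleftrightarrow> (\<exists>e\<in>E. s = e \<cdot> t)"
  by (simp add: natural_order_def)

text \<open>The order is left-right symmetric: \<open>e \<cdot> t\<close> equals \<open>t\<close>
  times the conjugate \<open>\<i> t \<cdot> e \<cdot> t\<close>, and \<open>mult_idem_eq\<close>
  gives the way back.\<close>

lemma nle_iff_right:
  assumes t: "t \<in> carrier S"
  shows "s \<preceq> t \<longleftrightarrow> (\<exists>e\<in>E. s = t \<cdot> e)"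
proof
  assume "s \<preceq> t"
  then obtain e where e: "e \<in> E" "s = e \<cdot> t" by (auto simp: nle_iff)
  have "s = t \<cdot> (\<i> t \<cdot> (e \<cdot> t))"
    using e t idem_left_commute[of e "t \<cdot> \<i> t" t] by (simp add: idem_closed)
  moreover have "\<i> t \<cdot> (e \<cdot> t) \<in> E"
    using conj_idem[of "\<i> t" e] e t by simp
  ultimately show "\<exists>e\<in>E. s = t \<cdot> e" by blast
next
  assume "\<exists>e\<in>E. s = t \<cdot> e"
  then show "s \<preceq> t"
    unfolding nle_iff using mult_idem_eq conj_idem t by blast
qed

lemma nle_antisym:
  assumes "s \<preceq> t" "t \<preceq> s" "s \<in> carrier S" "t \<in> carrier S"
  shows "s = t"
proof -
  obtain e f where "e \<in> E" "f \<in> E" "s = e \<cdot> t" "t = f \<cdot> s"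
    using assms by (auto simp: nle_iff)
  \<comment> \<open>As \<open>t = f \<cdot> e \<cdot> t\<close> and idempotents commute, \<open>s =
    e \<cdot> f \<cdot> e \<cdot> t = f \<cdot> e \<cdot> t = t\<close>.\<close>
  then show ?thesis
    using assms by (metis idem_closed idem_left_commute idem_idem_left)
qed

lemma nle_trans:
  assumes "s \<preceq> t" "t \<preceq> u" "u \<in> carrier S"
  shows "s \<preceq> u"
proof -
  obtain e f where "e \<in> E" "f \<in> E" "s = e \<cdot> t" "t = f \<cdot> u"
    using assms by (auto simp: nle_iff)
  then show ?thesis
    using assms by (auto simp: nle_iff idem_mult idem_closed intro!: bexI[of _ "e \<cdot> f"])
qed

lemma nle_mult_right:
  "\<lbrakk>s \<preceq> t; t \<in> carrier S; u \<in> carrier S\<rbrakk> \<Longrightarrow> s \<cdot> u \<preceq> t \<cdot> u"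
  by (auto simp: nle_iff idem_closed)

lemma nle_mult_left:
  "\<lbrakk>s \<preceq> t; t \<in> carrier S; u \<in> carrier S\<rbrakk> \<Longrightarrow> u \<cdot> s \<preceq> u \<cdot> t"
  by (auto simp: nle_iff_right idem_closed)

text \<open>Inverting \<open>e \<cdot> t\<close> puts the idempotent on the right, so the right-hand
  form of the order is what applies.\<close>

lemma nle_sinv:
  "\<lbrakk>s \<preceq> t; t \<in> carrier S\<rbrakk> \<Longrightarrow> \<i> s \<preceq> \<i> t"
  by (subst nle_iff_right) (auto simp: nle_iff idem_closed sinv_idem)

section \<open>Suprema in the natural order\<close>

lemma lub_closed [simp]: "is_lub (natural_order S) x A \<Longrightarrow> x \<in> carrier S"
  using least_closed by fastforce

lemma lub_unique:
  assumes "is_lub (natural_order S) x A" "is_lub (natural_order S) y A"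
  shows "x = y"
  using assms by (meson least_le least_mem lub_closed nle_antisym)

text \<open>Inversion is a monotone involution, hence an order automorphism: upper bounds
  \<open>y\<close> of the inverses correspond to upper bounds \<open>\<i> y\<close> of
  \<open>A\<close>.\<close>

lemma lub_sinv:
  assumes x: "is_lub (natural_order S) x A" and A: "A \<subseteq> carrier S"
  shows "is_lub (natural_order S) (\<i> x) (sinv S ` A)"
proof (rule least_UpperI)
  show "a \<preceq> \<i> x" if "a \<in> sinv S ` A" for a
    using that x A by (auto intro!: nle_sinv least_Upper_above)
  show "\<i> x \<preceq> y" if y: "y \<in> Upper (natural_order S) (sinv S ` A)" for y
  proof -
    have yc: "y \<in> carrier S" using y Upper_closed by fastforce
    have "a \<preceq> \<i> y" if "a \<in> A" for a
    proof -
      have "\<i> a \<preceq> y" using y that A by (auto simp: Upper_def)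
      then show ?thesis using nle_sinv[of "\<i> a" y] yc that A by auto
    qed
    then have "\<i> y \<in> Upper (natural_order S) A"
      using yc by (intro Upper_memI) auto
    then have "x \<preceq> \<i> y" by (rule least_le[OF x])
    then show ?thesis using nle_sinv[of x "\<i> y"] yc by simp
  qed
qed (use A x in auto)

section \<open>Compatible sets under inversion and translation\<close>

lemma compatible_subset: "compatible S A \<Longrightarrow> A \<subseteq> carrier S"
  by (simp add: compatible_def)

lemma compatible_sinv: "compatible S A \<Longrightarrow> compatible S (sinv S ` A)"
  by (auto simp: compatible_def subset_iff)

text \<open>One of the two conditions is conjugation of \<open>\<i> s \<cdot> t\<close> by
  \<open>b\<close>. For the other, \<open>b \<cdot> \<i> b\<close> is moved across \<open>s\<close>,
  which leaves the product of the idempotents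
  \<open>s \<cdot> b \<cdot> \<i> b \<cdot> \<i> s\<close> and
  \<open>s \<cdot> \<i> t\<close>.\<close>

lemma compatible_mult_right:
  assumes A: "compatible S A" and b: "b \<in> carrier S"
  shows "compatible S ((\<lambda>a. a \<cdot> b) ` A)"
proof -
  have "\<i> b \<cdot> (\<i> s \<cdot> (t \<cdot> b)) \<in> E \<and> s \<cdot> (b \<cdot> (\<i> b \<cdot> \<i> t)) \<in> E" if st: "s \<in> A" "t \<in> A" for s t
  proof
    have c [simp]: "s \<in> carrier S" "t \<in> carrier S" using st compatible_subset[OF A] by auto
    have e: "\<i> s \<cdot> t \<in> E" "s \<cdot> \<i> t \<in> E" using A st by (auto simp: compatible_def)
    show "\<i> b \<cdot> (\<i> s \<cdot> (t \<cdot> b)) \<in> E"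
      using conj_idem[OF _ e(1), of "\<i> b"] b by simp
    have "s \<cdot> (b \<cdot> \<i> b \<cdot> \<i> s) \<cdot> (s \<cdot> \<i> t) \<in> E"
      using b e conj_idem[of s "b \<cdot> \<i> b"] by (intro idem_mult[OF _ e(2)]) simp_all
    moreover have "s \<cdot> (b \<cdot> \<i> b) = s \<cdot> ((b \<cdot> \<i> b) \<cdot> \<i> s) \<cdot> s"
      using b by (intro mult_idem_eq) simp_all
    then have "s \<cdot> (b \<cdot> \<i> b) \<cdot> \<i> t = s \<cdot> ((b \<cdot> \<i> b) \<cdot> \<i> s) \<cdot> s \<cdot> \<i> t"
      by simp
    ultimately show "s \<cdot> (b \<cdot> (\<i> b \<cdot> \<i> t)) \<in> E"
      using b by simp
  qed
  then show ?thesis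
    using compatible_subset[OF A] b by (auto simp: compatible_def subset_iff)
qed

text \<open>Reduced to the right-hand case by
  \<open>b \<cdot> a = \<i> (\<i> a \<cdot> \<i> b)\<close>.\<close>

lemma compatible_mult_left:
  assumes A: "compatible S A" and b: "b \<in> carrier S"
  shows "compatible S ((\<lambda>a. b \<cdot> a) ` A)"
proof -
  have "compatible S (sinv S ` (\<lambda>a. a \<cdot> \<i> b) ` sinv S ` A)"
    using assms by (intro compatible_sinv compatible_mult_right) simp_all
  also have "sinv S ` (\<lambda>a. a \<cdot> \<i> b) ` sinv S ` A = (\<lambda>a. b \<cdot> a) ` A"
    unfolding image_image using compatible_subset[OF A] b by (intro image_cong) auto
  finally show ?thesis .
qed

section \<open>Compatibly closed ideals\<close>

lemma cc_ideal_subset: "U \<in> cc_ideals S \<Longrightarrow> U \<subseteq> carrier S"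
  by (simp add: cc_ideals_def)

lemma cc_idealD_closed: "\<lbrakk>U \<in> cc_ideals S; u \<in> U\<rbrakk> \<Longrightarrow> u \<in> carrier S"
  using cc_ideal_subset by blast

lemma cc_idealD_down: "\<lbrakk>U \<in> cc_ideals S; u \<in> U; s \<in> carrier S; s \<preceq> u\<rbrakk> \<Longrightarrow> s \<in> U"
  by (auto simp: cc_ideals_def)

lemma cc_idealD_lub:
  "\<lbrakk>U \<in> cc_ideals S; A \<subseteq> U; compatible S A; is_lub (natural_order S) x A\<rbrakk> \<Longrightarrow> x \<in> U"
  unfolding cc_ideals_def by blast

lemma cc_idealI:
  assumes "U \<subseteq> carrier S"
    and "\<And>u s. \<lbrakk>u \<in> U; s \<in> carrier S; s \<preceq> u\<rbrakk> \<Longrightarrow> s \<in> U"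
    and "\<And>A x. \<lbrakk>A \<subseteq> U; compatible S A; is_lub (natural_order S) x A\<rbrakk> \<Longrightarrow> x \<in> U"
  shows "U \<in> cc_ideals S"
  using assms unfolding cc_ideals_def by blast

lemma carrier_cc_ideal: "carrier S \<in> cc_ideals S"
  by (rule cc_idealI) auto

text \<open>Nonemptiness matters because \<open>\<Inter>{}\<close> is the whole type rather than
  \<open>carrier S\<close>.\<close>

lemma Inter_cc_ideal:
  assumes "\<U> \<subseteq> cc_ideals S" "\<U> \<noteq> {}"
  shows "\<Inter>\<U> \<in> cc_ideals S"
proof (rule cc_idealI)
  show "\<Inter>\<U> \<subseteq> carrier S" using assms cc_ideal_subset by blast
  show "s \<in> \<Inter>\<U>" if "u \<in> \<Inter>\<U>" "s \<in> carrier S" "s \<preceq> u" for u s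
    using that assms cc_idealD_down by blast
  show "x \<in> \<Inter>\<U>" if "A \<subseteq> \<Inter>\<U>" "compatible S A" "is_lub (natural_order S) x A" for A x
    using that assms cc_idealD_lub by (meson InterI Inter_lower subset_iff)
qed

section \<open>The compatible closure\<close>

abbreviation cl where "cl \<equiv> cc_closure S"

text \<open>For such \<open>A\<close> the family being intersected is nonempty, since
  \<open>carrier S\<close> belongs to it.\<close>

lemma cl_cc_ideal [simp]: "A \<subseteq> carrier S \<Longrightarrow> cl A \<in> cc_ideals S"
  unfolding cc_closure_def using carrier_cc_ideal by (intro Inter_cc_ideal) auto

lemma cl_subset [simp]: "A \<subseteq> carrier S \<Longrightarrow> cl A \<subseteq> carrier S"
  using cl_cc_ideal cc_ideal_subset by blast

lemma cl_least: "\<lbrakk>A \<subseteq> U; U \<in> cc_ideals S\<rbrakk> \<Longrightarrow> cl A \<subseteq> U"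
  unfolding cc_closure_def by blast

lemma cl_upper: "A \<subseteq> cl A"
  unfolding cc_closure_def by blast

lemma cl_mono: "A \<subseteq> B \<Longrightarrow> cl A \<subseteq> cl B"
  unfolding cc_closure_def by blast

lemma cl_fixed: "U \<in> cc_ideals S \<Longrightarrow> cl U = U"
  by (simp add: cl_least cl_upper subset_antisym)

lemma cl_eqI:
  assumes "A \<subseteq> cl B" "B \<subseteq> cl A" "A \<subseteq> carrier S" "B \<subseteq> carrier S"
  shows "cl A = cl B"
  using assms by (simp add: cl_least subset_antisym)

lemma sinv_cc_ideal:
  assumes U: "U \<in> cc_ideals S"
  shows "sinv S ` U \<in> cc_ideals S"
proof -
  \<comment> \<open>As inversion is an involution, the image of \<open>U\<close> is also its
    preimage; closure of \<open>U\<close> can then be pulled back along inversion.\<close>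
  have iff: "s \<in> sinv S ` U \<longleftrightarrow> \<i> s \<in> U" if "s \<in> carrier S" for s
    using that cc_ideal_subset[OF U] by (force intro: rev_image_eqI)
  show ?thesis
  proof (rule cc_idealI)
    show sub: "sinv S ` U \<subseteq> carrier S" using cc_ideal_subset[OF U] by auto
    show "s \<in> sinv S ` U" if "u \<in> sinv S ` U" "s \<in> carrier S" "s \<preceq> u" for u s
    proof -
      have "u \<in> carrier S" using that sub by blast
      then have "\<i> u \<in> U" "\<i> s \<preceq> \<i> u" using that iff nle_sinv by auto
      then show ?thesis using iff that cc_idealD_down[OF U] by simp
    qed
    show "x \<in> sinv S ` U"
      if "A \<subseteq> sinv S ` U" "compatible S A" "is_lub (natural_order S) x A" for A x
    proof -
      have "sinv S ` A \<subseteq> U" using that iff sub by blast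
      moreover have "is_lub (natural_order S) (\<i> x) (sinv S ` A)"
        using that compatible_subset by (intro lub_sinv)
      ultimately have "\<i> x \<in> U"
        using that compatible_sinv cc_idealD_lub[OF U] by blast
      then show ?thesis using iff that by simp
    qed
  qed
qed

lemma sinv_image_image: "A \<subseteq> carrier S \<Longrightarrow> sinv S ` sinv S ` A = A"
  by (force simp: image_image subset_iff)

lemma sinv_cl:
  assumes A: "A \<subseteq> carrier S"
  shows "sinv S ` cl A = cl (sinv S ` A)"
proof
  \<comment> \<open>Stated for all \<open>B\<close> because it is used twice: at \<open>A\<close>,
    and at the set of inverses of \<open>A\<close>, where inverting both sides yields the opposite
    inclusion.\<close>
  have sub: "cl (sinv S ` B) \<subseteq> sinv S ` cl B" if "B \<subseteq> carrier S" for B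
    using that cl_upper by (intro cl_least sinv_cc_ideal image_mono) simp_all
  show "cl (sinv S ` A) \<subseteq> sinv S ` cl A" by (rule sub[OF A])
  have A': "sinv S ` A \<subseteq> carrier S" using A by auto
  have "cl A \<subseteq> sinv S ` cl (sinv S ` A)"
    using sub[OF A'] sinv_image_image[OF A] by simp
  then have "sinv S ` cl A \<subseteq> sinv S ` sinv S ` cl (sinv S ` A)" by (rule image_mono)
  then show "sinv S ` cl A \<subseteq> cl (sinv S ` A)"
    using sinv_image_image[OF cl_subset[OF A']] by simp
qed

section \<open>Products of subsets and principal ideals\<close>

lemma set_smult_subset [simp]:
  "\<lbrakk>A \<subseteq> carrier S; B \<subseteq> carrier S\<rbrakk> \<Longrightarrow> set_smult S A B \<subseteq> carrier S"
  by (auto simp: set_smult_def intro!: smult_closed)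

lemma set_smult_mono:
  "\<lbrakk>A \<subseteq> A'; B \<subseteq> B'\<rbrakk> \<Longrightarrow> set_smult S A B \<subseteq> set_smult S A' B'"
  by (auto simp: set_smult_def)

lemma set_smult_assoc:
  assumes "A \<subseteq> carrier S" "B \<subseteq> carrier S" "C \<subseteq> carrier S"
  shows "set_smult S (set_smult S A B) C = set_smult S A (set_smult S B C)"
proof -
  have "set_smult S (set_smult S A B) C = {(a \<cdot> b) \<cdot> c | a b c. a \<in> A \<and> b \<in> B \<and> c \<in> C}"
    unfolding set_smult_def by blast
  also have "\<dots> = {a \<cdot> (b \<cdot> c) | a b c. a \<in> A \<and> b \<in> B \<and> c \<in> C}"
  proof -
    have "(a \<cdot> b) \<cdot> c = a \<cdot> (b \<cdot> c)" if "a \<in> A" "b \<in> B" "c \<in> C" for a b c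
      using that assms by (intro smult_assoc) auto
    then show ?thesis by (intro Collect_cong) metis
  qed
  also have "\<dots> = set_smult S A (set_smult S B C)"
    unfolding set_smult_def by blast
  finally show ?thesis .
qed

lemma sinv_set_smult:
  assumes "A \<subseteq> carrier S" "B \<subseteq> carrier S"
  shows "sinv S ` set_smult S A B = set_smult S (sinv S ` B) (sinv S ` A)"
proof -
  have "\<i> (a \<cdot> b) = \<i> b \<cdot> \<i> a" if "a \<in> A" "b \<in> B" for a b
    using that assms by (intro sinv_mult) auto
  then show ?thesis
    unfolding set_smult_def by (auto simp: image_iff) metis+
qed

lemma down_set_cc_ideal:
  assumes x: "x \<in> carrier S"
  shows "down_set S x \<in> cc_ideals S"
proof (rule cc_idealI)
  show "s \<in> down_set S x" if "u \<in> down_set S x" "s \<in> carrier S" "s \<preceq> u" for u s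
    using that x nle_trans by (auto simp: down_set_def)
  show "y \<in> down_set S x"
    if "A \<subseteq> down_set S x" "is_lub (natural_order S) y A" for A y
  proof -
    \<comment> \<open>The generator bounds every subset of its down-set, so a supremum of such a
      subset stays below it.\<close>
    have "x \<in> Upper (natural_order S) A"
      using that(1) x by (intro Upper_memI) (auto simp: down_set_def)
    then show ?thesis
      using that(2) least_le by (fastforce simp: down_set_def)
  qed
qed (auto simp: down_set_def)

section \<open>Polars and extents of the membership context\<close>

lemma polar_down_polar_up:
  assumes "A \<subseteq> carrier S"
  shows "polar_down (carrier S) (membership_context S)
      (polar_up (cc_ideals S) (membership_context S) A) = cl A"
proof -
  have "polar_up (cc_ideals S) (membership_context S) A = {U \<in> cc_ideals S. A \<subseteq> U}"
    using assms by (auto simp: polar_up_def membership_context_def)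
  \<comment> \<open>The lower polar takes points of \<open>carrier S\<close> only; this cuts nothing
    off, as the closure already lies there.\<close>
  then have "polar_down (carrier S) (membership_context S)
      (polar_up (cc_ideals S) (membership_context S) A) = carrier S \<inter> cl A"
    by (auto simp: polar_down_def membership_context_def cc_closure_def)
  then show ?thesis using cl_subset[OF assms] by blast
qed

text \<open>Extents are the fixed points of \<open>cl\<close>: every closure is an ideal, and every
  ideal is its own closure.\<close>

lemma extents_membership_context:
  "extents (carrier S) (cc_ideals S) (membership_context S) = cc_ideals S"
proof -
  have "A \<subseteq> carrier S \<and> A = polar_down (carrier S) (membership_context S)
      (polar_up (cc_ideals S) (membership_context S) A) \<longleftrightarrow> A \<in> cc_ideals S" for A
    using polar_down_polar_up[of A] cl_cc_ideal[of A] cl_fixed[of A] cc_ideal_subset[of A]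
    by metis
  then show ?thesis unfolding extents_def by blast
qed

end

section \<open>Complete pseudogroups\<close>

context complete_pseudogroup
begin

section \<open>The unit and the unit laws\<close>

text \<open>The unit is the supremum \<open>u\<close> of the compatible set \<open>E\<close>. By
  distributivity, \<open>u \<cdot> s\<close> is the supremum of all \<open>e \<cdot> s\<close>, and
  that supremum is \<open>s\<close>; likewise on the other side.\<close>

lemma unit_exists: "\<exists>u. u \<in> carrier S \<and> (\<forall>s\<in>carrier S. u \<cdot> s = s \<and> s \<cdot> u = s)"
proof -
  have E: "compatible S E"
    by (auto simp: compatible_def sinv_idem idem_mult idem_closed)
  then obtain u where u: "is_lub (natural_order S) u E" using complete by blast
  have "u \<cdot> s = s \<and> s \<cdot> u = s" if s: "s \<in> carrier S" for s
  proof
    have "is_lub (natural_order S) s ((\<lambda>a. a \<cdot> s) ` E)"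
    proof (rule least_UpperI)
      show "x \<preceq> s" if "x \<in> (\<lambda>a. a \<cdot> s) ` E" for x
        using that by (auto simp: nle_iff)
      show "s \<preceq> y" if "y \<in> Upper (natural_order S) ((\<lambda>a. a \<cdot> s) ` E)" for y
      proof -
        \<comment> \<open>The family contains \<open>s\<close> itself, at the idempotent
          \<open>s \<cdot> \<i> s\<close>, so each of its upper bounds is above
          \<open>s\<close>.\<close>
        have "(s \<cdot> \<i> s) \<cdot> s \<in> (\<lambda>a. a \<cdot> s) ` E" using s by (intro imageI) simp
        then show ?thesis using that s by (simp add: Upper_def)
      qed
    qed (use s in \<open>auto simp: idem_closed\<close>)
    then show "u \<cdot> s = s" using lub_unique distrib_right[OF E u s] by blast
    have "is_lub (natural_order S) s ((\<lambda>a. s \<cdot> a) ` E)"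
    proof (rule least_UpperI)
      show "x \<preceq> s" if "x \<in> (\<lambda>a. s \<cdot> a) ` E" for x
        using that s by (auto simp: nle_iff_right)
      show "s \<preceq> y" if "y \<in> Upper (natural_order S) ((\<lambda>a. s \<cdot> a) ` E)" for y
      proof -
        have "s \<cdot> (\<i> s \<cdot> s) \<in> (\<lambda>a. s \<cdot> a) ` E" using s by (intro imageI) simp
        then show ?thesis using that s by (simp add: Upper_def)
      qed
    qed (use s in \<open>auto simp: idem_closed\<close>)
    then show "s \<cdot> u = s" using lub_unique distrib_left[OF E u s] by blast
  qed
  then show ?thesis using lub_closed[OF u] by blast
qed

lemma sunit_props:
  "sunit S \<in> carrier S \<and> (\<forall>s\<in>carrier S. sunit S \<cdot> s = s \<and> s \<cdot> sunit S = s)"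
proof -
  have "\<exists>!u. u \<in> carrier S \<and> (\<forall>s\<in>carrier S. u \<cdot> s = s \<and> s \<cdot> u = s)"
    using unit_exists by (metis (no_types, lifting))
  then show ?thesis unfolding sunit_def by (rule theI')
qed

lemma sunit_closed [simp]: "sunit S \<in> carrier S"
  and sunit_left [simp]: "s \<in> carrier S \<Longrightarrow> sunit S \<cdot> s = s"
  and sunit_right [simp]: "s \<in> carrier S \<Longrightarrow> s \<cdot> sunit S = s"
  using sunit_props by auto

text \<open>Below the unit, the relation \<open>s = e \<cdot> sunit S\<close> just says
  \<open>s = e\<close>. The quantale unit can therefore be treated as \<open>E\<close>.\<close>

lemma down_set_sunit: "down_set S (sunit S) = E"
  by (auto simp: down_set_def nle_iff idem_closed)

text \<open>The unit laws hold before any closure is taken: \<open>e \<cdot> u\<close> and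
  \<open>u \<cdot> e\<close> lie below \<open>u\<close>, and \<open>E\<close> contains the unit of
  \<open>S\<close>.\<close>

lemma set_smult_idempotents:
  assumes U: "U \<in> cc_ideals S"
  shows "set_smult S E U = U" and "set_smult S U E = U"
proof -
  have 1: "sunit S \<in> E" by (simp add: idemI)
  have eu: "e \<cdot> u \<in> U \<and> u \<cdot> e \<in> U" if e: "e \<in> E" and u: "u \<in> U" for e u
  proof -
    have c: "u \<in> carrier S" "e \<in> carrier S"
      using cc_idealD_closed[OF U u] idem_closed[OF e] by this+
    have "e \<cdot> u \<preceq> u" using e unfolding nle_iff by (rule bexI[rotated]) simp
    moreover have "u \<cdot> e \<preceq> u"
      using e unfolding nle_iff_right[OF c(1)] by (rule bexI[rotated]) simp
    ultimately show ?thesis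
      using cc_idealD_down[OF U u] smult_closed c by simp
  qed
  have "u = sunit S \<cdot> u \<and> u = u \<cdot> sunit S" if "u \<in> U" for u
    using cc_idealD_closed[OF U that] by simp
  then have "U \<subseteq> set_smult S E U" "U \<subseteq> set_smult S U E"
    unfolding set_smult_def using 1 by blast+
  moreover have "set_smult S E U \<subseteq> U" "set_smult S U E \<subseteq> U"
    using eu by (auto simp: set_smult_def)
  ultimately show "set_smult S E U = U" "set_smult S U E = U" by blast+
qed

section \<open>Residuals and the nucleus property of the closure\<close>

text \<open>Right translation by each \<open>b\<close> preserves the order, compatibility and
  compatible suprema, so both closure properties of \<open>W\<close> pass to the elements that it
  sends into \<open>W\<close>.\<close>

lemma right_residual_cc_ideal:
  assumes W: "W \<in> cc_ideals S" and B: "B \<subseteq> carrier S"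
  shows "{x \<in> carrier S. \<forall>b\<in>B. x \<cdot> b \<in> W} \<in> cc_ideals S" (is "?U \<in> _")
proof (rule cc_idealI)
  show "s \<in> ?U" if u: "u \<in> ?U" and s: "s \<in> carrier S" "s \<preceq> u" for u s
  proof -
    have "s \<cdot> b \<in> W" if b: "b \<in> B" for b
    proof (rule cc_idealD_down[OF W])
      show "u \<cdot> b \<in> W" using u b by blast
      show "s \<cdot> b \<in> carrier S" using s b B by (blast intro: smult_closed)
      show "s \<cdot> b \<preceq> u \<cdot> b" using s u b B by (blast intro: nle_mult_right)
    qed
    then show ?thesis using s by blast
  qed
  show "x \<in> ?U"
    if A: "A \<subseteq> ?U" "compatible S A" "is_lub (natural_order S) x A" for A x
  proof -
    have "x \<cdot> b \<in> W" if b: "b \<in> B" for b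
    proof (rule cc_idealD_lub[OF W])
      have bc: "b \<in> carrier S" using b B by blast
      show "(\<lambda>a. a \<cdot> b) ` A \<subseteq> W" using A(1) b by blast
      show "compatible S ((\<lambda>a. a \<cdot> b) ` A)" by (rule compatible_mult_right[OF A(2) bc])
      show "is_lub (natural_order S) (x \<cdot> b) ((\<lambda>a. a \<cdot> b) ` A)" by (rule distrib_right[OF A(2,3) bc])
    qed
    then show ?thesis using lub_closed[OF A(3)] by blast
  qed
qed blast

lemma left_residual_cc_ideal:
  assumes W: "W \<in> cc_ideals S" and B: "B \<subseteq> carrier S"
  shows "{x \<in> carrier S. \<forall>b\<in>B. b \<cdot> x \<in> W} \<in> cc_ideals S" (is "?U \<in> _")
proof (rule cc_idealI)
  show "s \<in> ?U" if u: "u \<in> ?U" and s: "s \<in> carrier S" "s \<preceq> u" for u s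
  proof -
    have "b \<cdot> s \<in> W" if b: "b \<in> B" for b
    proof (rule cc_idealD_down[OF W])
      show "b \<cdot> u \<in> W" using u b by blast
      show "b \<cdot> s \<in> carrier S" using s b B by (blast intro: smult_closed)
      show "b \<cdot> s \<preceq> b \<cdot> u" using s u b B by (blast intro: nle_mult_left)
    qed
    then show ?thesis using s by blast
  qed
  show "x \<in> ?U"
    if A: "A \<subseteq> ?U" "compatible S A" "is_lub (natural_order S) x A" for A x
  proof -
    have "b \<cdot> x \<in> W" if b: "b \<in> B" for b
    proof (rule cc_idealD_lub[OF W])
      have bc: "b \<in> carrier S" using b B by blast
      show "(\<lambda>a. b \<cdot> a) ` A \<subseteq> W" using A(1) b by blast
      show "compatible S ((\<lambda>a. b \<cdot> a) ` A)" by (rule compatible_mult_left[OF A(2) bc])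
      show "is_lub (natural_order S) (b \<cdot> x) ((\<lambda>a. b \<cdot> a) ` A)" by (rule distrib_left[OF A(2,3) bc])
    qed
    then show ?thesis using lub_closed[OF A(3)] by blast
  qed
qed blast

text \<open>The residual of the closed product by \<open>B\<close> is an ideal containing
  \<open>A\<close>, hence contains \<open>cl A\<close>; the other factor is treated
  symmetrically.\<close>

lemma set_smult_cl_subset:
  assumes A: "A \<subseteq> carrier S" and B: "B \<subseteq> carrier S"
  shows "set_smult S (cl A) B \<subseteq> cl (set_smult S A B)"
    and "set_smult S A (cl B) \<subseteq> cl (set_smult S A B)"
proof -
  let ?W = "cl (set_smult S A B)"
  have W: "?W \<in> cc_ideals S" using A B by simp
  have ab: "a \<cdot> b \<in> ?W" if "a \<in> A" "b \<in> B" for a b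
  proof (rule subsetD[OF cl_upper])
    show "a \<cdot> b \<in> set_smult S A B" using that unfolding set_smult_def by blast
  qed
  have "cl A \<subseteq> {x \<in> carrier S. \<forall>b\<in>B. x \<cdot> b \<in> ?W}"
    by (rule cl_least[OF _ right_residual_cc_ideal[OF W B]]) (use A ab in blast)
  then show "set_smult S (cl A) B \<subseteq> ?W"
    \<comment> \<open>Only the outer product is unfolded; the one inside \<open>?W\<close> has to
      stay as it is.\<close>
    by (subst set_smult_def) blast
  have "cl B \<subseteq> {x \<in> carrier S. \<forall>a\<in>A. a \<cdot> x \<in> ?W}"
    by (rule cl_least[OF _ left_residual_cc_ideal[OF W A]]) (use B ab in blast)
  then show "set_smult S A (cl B) \<subseteq> ?W"
    by (subst set_smult_def) blast
qed

text \<open>This removes inner closures from iterated products and from products with suprema, which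
  is what associativity and distributivity require.\<close>

lemma cl_set_smult_cl:
  assumes A: "A \<subseteq> carrier S" and B: "B \<subseteq> carrier S"
  shows "cl (set_smult S (cl A) B) = cl (set_smult S A B)"
    and "cl (set_smult S A (cl B)) = cl (set_smult S A B)"
proof -
  have "set_smult S A B \<subseteq> set_smult S (cl A) B" "set_smult S A B \<subseteq> set_smult S A (cl B)"
    by (intro set_smult_mono cl_upper subset_refl)+
  note 1 = this[THEN subset_trans, OF cl_upper]
  note sub = set_smult_subset[OF A B] set_smult_subset[OF cl_subset[OF A] B]
    set_smult_subset[OF A cl_subset[OF B]]
  show "cl (set_smult S (cl A) B) = cl (set_smult S A B)"
    by (rule cl_eqI[OF set_smult_cl_subset(1)[OF A B] 1(1) sub(2,1)])
  show "cl (set_smult S A (cl B)) = cl (set_smult S A B)"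
    by (rule cl_eqI[OF set_smult_cl_subset(2)[OF A B] 1(2) sub(3,1)])
qed

lemma cl_Union_cl:
  assumes "\<And>i. i \<in> I \<Longrightarrow> F i \<subseteq> carrier S"
  shows "cl (\<Union>i\<in>I. cl (F i)) = cl (\<Union>i\<in>I. F i)"
proof (rule cl_eqI)
  show "(\<Union>i\<in>I. cl (F i)) \<subseteq> cl (\<Union>i\<in>I. F i)" by (intro UN_least cl_mono) blast
  have "(\<Union>i\<in>I. F i) \<subseteq> (\<Union>i\<in>I. cl (F i))" using cl_upper by fastforce
  then show "(\<Union>i\<in>I. F i) \<subseteq> cl (\<Union>i\<in>I. cl (F i))" using cl_upper by (rule subset_trans)
  show "(\<Union>i\<in>I. cl (F i)) \<subseteq> carrier S" "(\<Union>i\<in>I. F i) \<subseteq> carrier S"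
    by (intro UN_least cl_subset assms; assumption)+
qed

section \<open>The quantale of compatibly closed ideals\<close>

text \<open>Both structures have the ideals as carrier, ordered by inclusion. Working with an
  arbitrary such \<open>Q\<close> allows the quantale axioms to be checked once for both.\<close>

context
  fixes Q :: "('a set, 'c) quantale_struct_scheme"
  assumes carrier_Q: "carrier Q = cc_ideals S"
    and eq_Q: "eq Q = (=)"
    and le_Q: "le Q = (\<subseteq>)"
begin

lemma is_lub_cl_Union:
  assumes "\<U> \<subseteq> cc_ideals S"
  shows "is_lub Q (cl (\<Union>\<U>)) \<U>"
proof (rule least_UpperI)
  have sub: "\<Union>\<U> \<subseteq> carrier S" using assms cc_ideal_subset by blast
  show "U \<sqsubseteq>\<^bsub>Q\<^esub> cl (\<Union>\<U>)" if "U \<in> \<U>" for U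
    using that cl_upper[of "\<Union>\<U>"] by (auto simp: le_Q)
  show "cl (\<Union>\<U>) \<sqsubseteq>\<^bsub>Q\<^esub> V" if "V \<in> Upper Q \<U>" for V
  proof -
    have "V \<in> cc_ideals S" "\<Union>\<U> \<subseteq> V"
      using that assms by (auto simp: Upper_def carrier_Q le_Q)
    then show ?thesis by (simp add: le_Q cl_least)
  qed
  show "\<U> \<subseteq> carrier Q" "cl (\<Union>\<U>) \<in> carrier Q"
    using assms sub by (auto simp: carrier_Q)
qed

text \<open>The supremum of an order structure is a \<open>SOME\<close> choice among least upper
  bounds; antisymmetry of inclusion leaves only one candidate.\<close>

lemma sup_eq_cl_Union:
  assumes "\<U> \<subseteq> cc_ideals S"
  shows "\<Squnion>\<^bsub>Q\<^esub>\<U> = cl (\<Union>\<U>)"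
proof -
  have "U = cl (\<Union>\<U>)" if "is_lub Q U \<U>" for U
    using that is_lub_cl_Union[OF assms] unfolding least_def le_Q by blast
  then show ?thesis
    unfolding sup_def using is_lub_cl_Union[OF assms] by (rule some_equality[rotated])
qed

text \<open>A top element and infima of nonempty families suffice; they are \<open>carrier S\<close>
  and intersections.\<close>

lemma complete_lattice_cc_ideals: "complete_lattice Q"
proof -
  interpret partial_order Q
    by unfold_locales (auto simp: carrier_Q eq_Q le_Q)
  show ?thesis
  proof (rule complete_lattice_criterion1)
    show "\<exists>g. greatest Q g (carrier Q)"
      using carrier_cc_ideal cc_ideal_subset
      by (auto simp: greatest_def carrier_Q le_Q intro!: exI[of _ "carrier S"])
    show "\<exists>i. greatest Q i (Lower Q \<U>)" if "\<U> \<subseteq> carrier Q" "\<U> \<noteq> {}" for \<U>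
    proof (rule exI, rule greatest_LowerI)
      show "\<Inter>\<U> \<in> carrier Q" using that Inter_cc_ideal by (simp add: carrier_Q)
      show "\<Inter>\<U> \<sqsubseteq>\<^bsub>Q\<^esub> U" if "U \<in> \<U>" for U using that by (auto simp: le_Q)
      show "V \<sqsubseteq>\<^bsub>Q\<^esub> \<Inter>\<U>" if "V \<in> Lower Q \<U>" for V
        using that \<open>\<U> \<subseteq> carrier Q\<close> by (auto simp: Lower_def le_Q)
    qed (use that in auto)
  qed
qed

text \<open>The operations are prescribed on ideals only, since \<open>context_closure\<close> is
  identified with \<open>cl\<close> just for subsets of the carrier.\<close>

lemma unital_involutive_quantale_cc_ideals:
  assumes mult: "\<And>U V. \<lbrakk>U \<in> cc_ideals S; V \<in> cc_ideals S\<rbrakk> \<Longrightarrow> qmult Q U V = cl (set_smult S U V)"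
    and unit: "qunit Q = down_set S (sunit S)"
    and invol: "\<And>U. U \<in> cc_ideals S \<Longrightarrow> qinvol Q U = sinv S ` U"
  shows "unital_involutive_quantale Q"
proof -
  interpret complete_lattice Q by (rule complete_lattice_cc_ideals)
  note sub = cc_ideal_subset
  have mult_closed: "qmult Q U V \<in> cc_ideals S" if "U \<in> cc_ideals S" "V \<in> cc_ideals S" for U V
    using that sub by (simp add: mult)
  have Un: "\<Union>\<U> \<subseteq> carrier S" if "\<U> \<subseteq> cc_ideals S" for \<U>
    using that sub by blast
  have E: "E \<in> cc_ideals S"
    using down_set_cc_ideal[OF sunit_closed] by (simp add: down_set_sunit)
  show ?thesis
  proof
    fix U V W assume UVW: "U \<in> carrier Q" "V \<in> carrier Q" "W \<in> carrier Q"
    then have c: "U \<in> cc_ideals S" "V \<in> cc_ideals S" "W \<in> cc_ideals S"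
      by (simp_all add: carrier_Q)
    \<comment> \<open>Both bracketings reduce to the closure of the same triple product.\<close>
    have "qmult Q (qmult Q U V) W = cl (set_smult S (set_smult S U V) W)"
      using c sub mult_closed[of U V] by (simp add: mult cl_set_smult_cl(1))
    also have "\<dots> = cl (set_smult S U (set_smult S V W))"
      using c sub by (simp add: set_smult_assoc)
    also have "\<dots> = qmult Q U (qmult Q V W)"
      using c sub mult_closed[of V W] by (simp add: mult cl_set_smult_cl(2))
    finally show "qmult Q (qmult Q U V) W = qmult Q U (qmult Q V W)" .
  next
    fix U \<V> assume "U \<in> carrier Q" "\<V> \<subseteq> carrier Q"
    then have c: "U \<in> cc_ideals S" "\<V> \<subseteq> cc_ideals S" by (simp_all add: carrier_Q)
    have smult_sub: "set_smult S U V \<subseteq> carrier S" if "V \<in> \<V>" for V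
      using c sub that by (intro set_smult_subset) blast+
    have im: "qmult Q U ` \<V> = (\<lambda>V. cl (set_smult S U V)) ` \<V>"
      using c mult by (intro image_cong) auto
    \<comment> \<open>The supremum is a closed union: its closure is dropped inside the product, the
      product distributes over the plain union, and closing the members turns the result into a
      supremum again.\<close>
    have "qmult Q U (\<Squnion>\<^bsub>Q\<^esub>\<V>) = cl (set_smult S U (\<Union>\<V>))"
      using c sub Un[OF c(2)] by (simp add: sup_eq_cl_Union mult cl_set_smult_cl(2))
    also have "set_smult S U (\<Union>\<V>) = (\<Union>V\<in>\<V>. set_smult S U V)"
      by (auto simp: set_smult_def)
    also have "cl \<dots> = cl (\<Union>V\<in>\<V>. cl (set_smult S U V))"
      by (rule cl_Union_cl[symmetric, OF smult_sub])
    also have "\<dots> = \<Squnion>\<^bsub>Q\<^esub>(qmult Q U ` \<V>)"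
      unfolding im by (subst sup_eq_cl_Union) (use smult_sub in auto)
    finally show "qmult Q U (\<Squnion>\<^bsub>Q\<^esub>\<V>) = \<Squnion>\<^bsub>Q\<^esub>(qmult Q U ` \<V>)" .
  next
    fix \<U> V assume "\<U> \<subseteq> carrier Q" "V \<in> carrier Q"
    then have c: "V \<in> cc_ideals S" "\<U> \<subseteq> cc_ideals S" by (simp_all add: carrier_Q)
    have smult_sub: "set_smult S U V \<subseteq> carrier S" if "U \<in> \<U>" for U
      using c sub that by (intro set_smult_subset) blast+
    have im: "(\<lambda>U. qmult Q U V) ` \<U> = (\<lambda>U. cl (set_smult S U V)) ` \<U>"
      using c mult by (intro image_cong) auto
    have "qmult Q (\<Squnion>\<^bsub>Q\<^esub>\<U>) V = cl (set_smult S (\<Union>\<U>) V)"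
      using c sub Un[OF c(2)] by (simp add: sup_eq_cl_Union mult cl_set_smult_cl(1))
    also have "set_smult S (\<Union>\<U>) V = (\<Union>U\<in>\<U>. set_smult S U V)"
      by (auto simp: set_smult_def)
    also have "cl \<dots> = cl (\<Union>U\<in>\<U>. cl (set_smult S U V))"
      by (rule cl_Union_cl[symmetric, OF smult_sub])
    also have "\<dots> = \<Squnion>\<^bsub>Q\<^esub>((\<lambda>U. qmult Q U V) ` \<U>)"
      unfolding im by (subst sup_eq_cl_Union) (use smult_sub in auto)
    finally show "qmult Q (\<Squnion>\<^bsub>Q\<^esub>\<U>) V = \<Squnion>\<^bsub>Q\<^esub>((\<lambda>U. qmult Q U V) ` \<U>)" .
  next
    fix \<U> assume "\<U> \<subseteq> carrier Q"
    then have c: "\<U> \<subseteq> cc_ideals S" by (simp add: carrier_Q)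
    have im: "qinvol Q ` \<U> = (`) (sinv S) ` \<U>"
      using c invol by (intro image_cong) auto
    \<comment> \<open>Pointwise inversion commutes with closure and, as a direct image, with
      unions.\<close>
    have "qinvol Q (\<Squnion>\<^bsub>Q\<^esub>\<U>) = cl (sinv S ` \<Union>\<U>)"
      using c Un[OF c] by (simp add: sup_eq_cl_Union invol sinv_cl)
    also have "\<dots> = \<Squnion>\<^bsub>Q\<^esub>(qinvol Q ` \<U>)"
      unfolding im using c by (subst sup_eq_cl_Union) (auto simp: image_Union intro!: sinv_cc_ideal)
    finally show "qinvol Q (\<Squnion>\<^bsub>Q\<^esub>\<U>) = \<Squnion>\<^bsub>Q\<^esub>(qinvol Q ` \<U>)" .
  next
    fix U V assume "U \<in> carrier Q" "V \<in> carrier Q"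
    then have c: "U \<in> cc_ideals S" "V \<in> cc_ideals S" by (simp_all add: carrier_Q)
    then show "qinvol Q (qmult Q U V) = qmult Q (qinvol Q V) (qinvol Q U)"
      using sub mult_closed[OF c]
      by (simp add: invol mult sinv_cc_ideal sinv_cl sinv_set_smult)
  \<comment> \<open>What remains are the closure conditions, the unit laws with \<open>E\<close> as
    unit, and the involutivity of inversion.\<close>
  qed (simp_all add: carrier_Q mult_closed invol sinv_cc_ideal sinv_image_image sub unit
      down_set_sunit E mult set_smult_idempotents cl_fixed)
qed

end

section \<open>Comparison of the two quantales\<close>

lemma context_closure_eq_cl: "A \<subseteq> carrier S \<Longrightarrow> context_closure S A = cl A"
  unfolding context_closure_def by (rule polar_down_polar_up)

lemma context_quantale_isomorphic: "context_quantale S \<cong>\<^sub>u\<^sub>i\<^sub>q ideal_quantale S"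
proof -
  have mult: "context_closure S (set_smult S U V) = cl (set_smult S U V)"
    if "U \<in> cc_ideals S" "V \<in> cc_ideals S" for U V
    using that cc_ideal_subset by (simp add: context_closure_eq_cl)
  have "unital_involutive_quantale (context_quantale S)"
    by (rule unital_involutive_quantale_cc_ideals)
      (simp_all add: context_quantale_def extents_membership_context mult)
  moreover have "unital_involutive_quantale (ideal_quantale S)"
    by (rule unital_involutive_quantale_cc_ideals) (simp_all add: ideal_quantale_def)
  \<comment> \<open>Suprema in the two structures are separate choices; they agree because each is
    the closure of the union, so \<open>id\<close> preserves them.\<close>
  moreover have "\<Squnion>\<^bsub>context_quantale S\<^esub>\<U> = \<Squnion>\<^bsub>ideal_quantale S\<^esub>\<U>" if "\<U> \<subseteq> cc_ideals S" for \<U>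
    using that by (subst (1 2) sup_eq_cl_Union)
      (simp_all add: context_quantale_def ideal_quantale_def extents_membership_context)
  then have "id \<in> uiq_iso (context_quantale S) (ideal_quantale S)"
    by (simp add: uiq_iso_def context_quantale_def ideal_quantale_def
        extents_membership_context mult)
  ultimately show ?thesis unfolding uiq_isomorphic_def by blast
qed

end

theorem proposition8p3:
  fixes S :: "('a, 'b) semigroup_struct_scheme"
  assumes "complete_pseudogroup S"
  shows "(\<forall>A. A \<subseteq> carrier S \<longrightarrow>
            polar_down (carrier S) (membership_context S)
              (polar_up (cc_ideals S) (membership_context S) A) = cc_closure S A)
       \<and> extents (carrier S) (cc_ideals S) (membership_context S) = cc_ideals S
       \<and> context_quantale S \<cong>\<^sub>u\<^sub>i\<^sub>q ideal_quantale S"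
proof -
  interpret complete_pseudogroup S by (rule assms)
  show ?thesis
    using polar_down_polar_up extents_membership_context context_quantale_isomorphic by blast
qed

end
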